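(* Let $C_n$ be a cycle on $n$ vertices. For every vertex $a\in V(C_n)$, $d_d(a)=\lceil n/3\rceil$.
   Context: A dominating set of a finite simple graph $G$ is a set $D\subseteq V(G)$ such that every vertex in $V(G)\setminus D$ is adjacent to some vertex of $D$. A minimal dominating set is a dominating set that does not properly contain any other dominating set. The domination degree of a vertex $a$ is $d_d(a)=\min\{|D| : D \text{ is a minimal dominating set of } G \text{ with } a\in D\}$. Cycles are simple graphs, so $n\ge 3$. *)

theory Defs
  imports Complex_Main "Graph_Theory.Digraph"
begin

definition dominating_set :: "('a, 'b) pre_digraph \<Rightarrow> 'a set \<Rightarrow> bool" where
  "dominating_set G D \<longleftrightarrow>
     D \<subseteq> verts G \<and> (\<forall>v \<in> verts G - D. \<exists>u \<in> D. v \<rightarrow>\<^bsub>G\<^esub> u)"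

definition minimal_dominating_set :: "('a, 'b) pre_digraph \<Rightarrow> 'a set \<Rightarrow> bool" where
  "minimal_dominating_set G D \<longleftrightarrow>
     dominating_set G D \<and> \<not> (\<exists>D'. dominating_set G D' \<and> D' \<subset> D)"

definition domination_degree :: "('a, 'b) pre_digraph \<Rightarrow> 'a \<Rightarrow> nat" where
  "domination_degree G a = Min {card D | D. minimal_dominating_set G D \<and> a \<in> D}"

(* The locale predicate graph of Graph_Theory describes finite simple graphs: finite,
   loop-free, without parallel arcs, every edge being a pair of opposite arcs. Hence
   both orientations of each edge of the cycle v 0, ..., v (n - 1) are listed.
   The bound on n has to be required: for n = 2 the remaining conditions describe K_2. *)
definition cycle_graph :: "nat \<Rightarrow> ('a, 'b) pre_digraph \<Rightarrow> bool" where
  "cycle_graph n G \<longleftrightarrow>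
     3 \<le> n \<and> graph G \<and>
     (\<exists>v. bij_betw v {..<n} (verts G) \<and>
          arcs_ends G = (\<Union>i<n. {(v i, v ((i + 1) mod n)), (v ((i + 1) mod n), v i)}))"

end

theory Submission
  imports Defs
begin

text \<open>
  In a cycle every vertex dominates exactly three vertices, itself and its two neighbours.
  Counting therefore gives \<open>n \<le> 3 * card D\<close> for every dominating set \<open>D\<close>
  (\<open>card_verts_le_dominating\<close>, \<open>cycle_dominating_lower\<close>), so that no dominating set has fewer
  than \<open>\<lceil>n / 3\<rceil>\<close> elements.

  Conversely, starting at \<open>a\<close> and walking around the cycle, every third vertex is picked. The
  \<open>\<lceil>n / 3\<rceil>\<close> picked vertices dominate the cycle (\<open>cycle_dominating_every_third\<close>). A proper
  subset would violate the lower bound, so this dominating set, which contains \<open>a\<close>, is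
  minimal; that minimality comes for free is what makes the domination degree of each vertex
  agree with the domination number of the cycle.
\<close>

text \<open>The closed neighbourhoods of the elements of a dominating set cover the vertices, and in a
  graph of maximum degree \<open>d\<close> each of them has at most \<open>d + 1\<close> elements.\<close>

lemma card_verts_le_dominating:
  assumes D: "dominating_set G D"
    and fin: "finite (verts G)"
    and nbrs: "\<And>u. u \<in> verts G \<Longrightarrow>
      finite {x. x \<rightarrow>\<^bsub>G\<^esub> u} \<and> card {x. x \<rightarrow>\<^bsub>G\<^esub> u} \<le> d"
  shows "card (verts G) \<le> (d + 1) * card D"
proof -
  let ?N = "\<lambda>u. insert u {x. x \<rightarrow>\<^bsub>G\<^esub> u}"
  have sub: "D \<subseteq> verts G"
    using D by (simp add: dominating_set_def)
  have finD: "finite D"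
    using sub fin by (rule finite_subset)
  have cover: "verts G \<subseteq> (\<Union>u\<in>D. ?N u)"
    using D by (auto simp: dominating_set_def)
  have finN: "finite (?N u)" if "u \<in> D" for u
    using nbrs[of u] sub that by blast
  have cardN: "card (?N u) \<le> d + 1" if u: "u \<in> D" for u
  proof (rule card_insert_le_m1)
    show "card {x. x \<rightarrow>\<^bsub>G\<^esub> u} \<le> d + 1 - 1"
      using nbrs[of u] sub u by fastforce
  qed simp
  have "card (verts G) \<le> card (\<Union>u\<in>D. ?N u)"
    using finD finN by (intro card_mono[OF _ cover] finite_UN_I)
  also have "\<dots> \<le> (\<Sum>u\<in>D. card (?N u))"
    by (rule card_UN_le[OF finD])
  also have "\<dots> \<le> (\<Sum>u\<in>D. d + 1)"
    by (rule sum_mono) (rule cardN)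
  finally show ?thesis
    by (simp add: mult.commute)
qed

text \<open>Reading indices modulo \<open>n\<close> lets the cycle be walked around from any starting vertex
  without treating the wrap-around separately.\<close>

lemma cycle_step:
  fixes n :: nat
  assumes ends: "arcs_ends G = (\<Union>i<n. {(v i, v ((i + 1) mod n)), (v ((i + 1) mod n), v i)})"
    and n: "0 < n"
  shows "v (i mod n) \<rightarrow>\<^bsub>G\<^esub> v (Suc i mod n)" and "v (Suc i mod n) \<rightarrow>\<^bsub>G\<^esub> v (i mod n)"
proof -
  have "Suc (i mod n) mod n = Suc i mod n"
    by (simp add: mod_Suc_eq)
  moreover have "i mod n < n"
    using n by simp
  ultimately show "v (i mod n) \<rightarrow>\<^bsub>G\<^esub> v (Suc i mod n)" "v (Suc i mod n) \<rightarrow>\<^bsub>G\<^esub> v (i mod n)"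
    unfolding ends by (auto intro!: bexI[of _ "i mod n"])
qed

lemma cycle_neighbours:
  fixes n :: nat
  assumes inj: "inj_on v {..<n}"
    and ends: "arcs_ends G = (\<Union>i<n. {(v i, v ((i + 1) mod n)), (v ((i + 1) mod n), v i)})"
    and i: "i < n"
  shows "{x. x \<rightarrow>\<^bsub>G\<^esub> v i} \<subseteq> {v ((i + 1) mod n), v ((i + n - 1) mod n)}"
proof
  fix x assume "x \<in> {x. x \<rightarrow>\<^bsub>G\<^esub> v i}"
  then obtain j where j: "j < n"
    and "x = v j \<and> v i = v ((j + 1) mod n) \<or> x = v ((j + 1) mod n) \<and> v i = v j"
    unfolding ends by auto
  then consider "x = v j" "i = (j + 1) mod n" | "x = v ((i + 1) mod n)"
    using inj i j by (auto dest!: inj_onD)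
  then show "x \<in> {v ((i + 1) mod n), v ((i + n - 1) mod n)}"
  proof cases
    case 1
    have "(i + n - 1) mod n = j"
    proof (cases "j + 1 = n")
      case True
      then show ?thesis using 1 j by simp
    next
      case False
      then show ?thesis using 1 j by simp
    qed
    then show ?thesis using 1 by simp
  qed simp
qed

lemma cycle_dominating_lower:
  fixes n :: nat
  assumes bij: "bij_betw v {..<n} (verts G)"
    and ends: "arcs_ends G = (\<Union>i<n. {(v i, v ((i + 1) mod n)), (v ((i + 1) mod n), v i)})"
    and D: "dominating_set G D"
  shows "n \<le> 3 * card D"
proof -
  have "finite {x. x \<rightarrow>\<^bsub>G\<^esub> u} \<and> card {x. x \<rightarrow>\<^bsub>G\<^esub> u} \<le> 2" if u: "u \<in> verts G" for u
  proof -
    obtain i where i: "i < n" "u = v i"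
      using bij u by (auto simp: bij_betw_def)
    let ?S = "{v ((i + 1) mod n), v ((i + n - 1) mod n)}"
    have sub: "{x. x \<rightarrow>\<^bsub>G\<^esub> u} \<subseteq> ?S"
      using cycle_neighbours[OF _ ends i(1)] bij i(2) by (simp add: bij_betw_def)
    moreover have "card ?S \<le> 2"
      by (simp add: card_insert_if)
    ultimately show ?thesis
      using card_mono[OF _ sub] finite_subset[OF sub] by fastforce
  qed
  moreover have "finite (verts G)" and "card (verts G) = n"
    using bij_betw_finite[OF bij] bij_betw_same_card[OF bij] by simp_all
  ultimately show ?thesis
    using card_verts_le_dominating[OF D, of 2] by simp
qed

text \<open>A vertex at distance \<open>d\<close> after the starting point \<open>v k\<close> is picked if \<open>3\<close> divides \<open>d\<close>;
  otherwise its predecessor or its successor is picked. The only exception to the naive count is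
  the last vertex: its successor is \<open>v k\<close> itself, which is picked even when \<open>3\<close> does not divide
  \<open>n\<close>.\<close>

lemma cycle_dominating_every_third:
  fixes n :: nat
  assumes bij: "bij_betw v {..<n} (verts G)"
    and ends: "arcs_ends G = (\<Union>i<n. {(v i, v ((i + 1) mod n)), (v ((i + 1) mod n), v i)})"
    and k: "k < n"
  shows "dominating_set G ((\<lambda>j. v ((k + 3 * j) mod n)) ` {..<(n + 2) div 3})"
    (is "dominating_set G (?p ` {..<?m})")
  unfolding dominating_set_def
proof (intro conjI ballI)
  have n: "0 < n" using k by simp
  show "?p ` {..<?m} \<subseteq> verts G"
    using bij n by (auto simp: bij_betw_def)
  fix x assume x: "x \<in> verts G - ?p ` {..<?m}"
  then obtain i where i: "i < n" "x = v i"
    using bij by (auto simp: bij_betw_def)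
  define d where "d = (i + (n - k)) mod n"
  have d: "d < n"
    using n by (simp add: d_def)
  have "(k + d) mod n = (k + (i + (n - k))) mod n"
    unfolding d_def by (rule mod_add_right_eq)
  also have "\<dots> = i"
    using i k by simp
  finally have xd: "x = v ((k + d) mod n)"
    using i by simp
  consider j where "d = 3 * j" | j where "d = Suc (3 * j)" | j where "Suc d = 3 * j"
  proof -
    have "d = 3 * (d div 3) \<or> d = Suc (3 * (d div 3)) \<or> Suc d = 3 * Suc (d div 3)"
      by presburger
    then show thesis using that by blast
  qed
  then show "\<exists>u\<in>?p ` {..<?m}. x \<rightarrow>\<^bsub>G\<^esub> u"
  proof cases
    case (1 j)
    then have "x = ?p j" "j < ?m"
      using xd d by auto
    then show ?thesis using x by auto
  next
    case (2 j)
    then have "x \<rightarrow>\<^bsub>G\<^esub> ?p j" "j < ?m"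
      using cycle_step(2)[OF ends n, of "k + 3 * j"] xd d by auto
    then show ?thesis by blast
  next
    case (3 j)
    then have "Suc (k + d) = k + 3 * j" by simp
    then have adj: "x \<rightarrow>\<^bsub>G\<^esub> ?p j"
      using cycle_step(1)[OF ends n, of "k + d"] xd by (simp only:)
    show ?thesis
    proof (cases "3 * j = n")
      case True
      then have "x \<rightarrow>\<^bsub>G\<^esub> ?p 0" using adj by simp
      moreover have "0 < ?m" using n by simp
      ultimately show ?thesis by blast
    next
      case False
      then have "j < ?m" using 3 d by simp
      then show ?thesis using adj by blast
    qed
  qed
qed

theorem theorem3p15:
  fixes G :: "('a, 'b) pre_digraph" and n :: nat and a :: 'a
  assumes "cycle_graph n G"
    and "a \<in> verts G"
  shows "int (domination_degree G a) = \<lceil>real n / 3\<rceil>"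
proof -
  obtain v where bij: "bij_betw v {..<n} (verts G)"
    and ends: "arcs_ends G = (\<Union>i<n. {(v i, v ((i + 1) mod n)), (v ((i + 1) mod n), v i)})"
    and n: "3 \<le> n"
    using assms(1) unfolding cycle_graph_def by blast
  obtain k where k: "k < n" "a = v k"
    using bij assms(2) by (auto simp: bij_betw_def)
  define m where "m = (n + 2) div 3"
  have lower: "m \<le> card D" if "dominating_set G D" for D
    using cycle_dominating_lower[OF bij ends that] by (simp add: m_def)
  define P where "P = (\<lambda>j. v ((k + 3 * j) mod n)) ` {..<m}"
  have domP: "dominating_set G P"
    unfolding P_def m_def by (rule cycle_dominating_every_third[OF bij ends k(1)])
  have cardP: "card P = m"
    using lower[OF domP] card_image_le[of "{..<m}" "\<lambda>j. v ((k + 3 * j) mod n)"]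
    by (simp add: P_def)
  have "\<not> D' \<subset> P" if "dominating_set G D'" for D'
    using lower[OF that] psubset_card_mono[of P D'] cardP by (auto simp: P_def)
  then have minP: "minimal_dominating_set G P"
    using domP by (auto simp: minimal_dominating_set_def)
  have aP: "a \<in> P"
    using k n by (auto simp: P_def m_def intro!: image_eqI[of _ _ 0])
  have finV: "finite (verts G)"
    using bij_betw_finite[OF bij] by simp
  let ?C = "{card D | D. minimal_dominating_set G D \<and> a \<in> D}"
  have "finite ?C"
  proof (rule finite_subset)
    show "?C \<subseteq> card ` Pow (verts G)"
      by (auto simp: minimal_dominating_set_def dominating_set_def)
  qed (use finV in simp)
  then have "domination_degree G a = m"
    unfolding domination_degree_def
  proof (rule Min_eqI)
    show "m \<le> c" if "c \<in> ?C" for c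
      using that lower by (auto simp: minimal_dominating_set_def)
    show "m \<in> ?C"
      using minP aP cardP by blast
  qed
  moreover have "\<lceil>real n / 3\<rceil> = int m"
  proof (rule ceiling_unique)
    have "n \<le> 3 * m" "3 * m < n + 3"
      by (auto simp: m_def)
    then show "real_of_int (int m) - 1 < real n / 3" "real n / 3 \<le> real_of_int (int m)"
      by linarith+
  qed
  ultimately show ?thesis
    by simp
qed

end
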